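(* Let $r$ be a positive integer and let $n_1,\ldots,n_r$ be nonnegative integers. The caterpillar $S_{n_1,n_2,\ldots,n_r}$ has a $b$-edge consecutive magic labeling if and only if $$b \in \left\{0,\ \sum_{i=1}^{\lceil r/2\rceil}n_{2i-1}+\left\lfloor\frac{r}{2}\right\rfloor,\ \sum_{i=1}^{\lfloor r/2\rfloor}n_{2i}+\left\lceil\frac{r}{2}\right\rceil,\ \sum_{i=1}^r n_i+r\right\}.$$
   Context: Graphs are finite and simple, with vertex set $V(G)$ and edge set $E(G)$. An edge-magic total labeling (also called edge-magic labeling or magic valuation) of $G$ is a bijection $\lambda: V(G)\cup E(G)\to\{1,2,\ldots,|V(G)|+|E(G)|\}$ such that $\lambda(x)+\lambda(y)+\lambda(xy)$ is the same constant (the magic constant of $\lambda$) for all edges $xy\in E(G)$. For an integer $b$ with $0\le b\le |V(G)|$, a $b$-edge consecutive magic labeling of $G$ is an edge-magic total labeling $\lambda$ with $\lambda(E(G))=\{b+1,b+2,\ldots,b+|E(G)|\}$. The caterpillar $S_{n_1,\ldots,n_r}$ is the tree obtained from a path $c_1c_2\cdots c_r$ on $r$ vertices by joining $n_i$ new leaves to $c_i$ for each $i=1,\ldots,r$. *)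

theory Defs
  imports Complex_Main
begin

text \<open>A graph is given by a vertex set \<open>V\<close> and a set \<open>E\<close> of edges, where the edge \<open>xy\<close>
  is the two-element set \<open>{x, y}\<close>.\<close>

definition finite_simple_graph :: "'a set \<Rightarrow> 'a set set \<Rightarrow> bool" where
  "finite_simple_graph V E \<longleftrightarrow> finite V \<and> (\<forall>e\<in>E. e \<subseteq> V \<and> card e = 2)"

text \<open>Labelings live on the disjoint union \<open>V <+> E\<close>: \<open>Inl x\<close> is the vertex \<open>x\<close>
  and \<open>Inr e\<close> is the edge \<open>e\<close>.\<close>

definition edge_magic_total ::
    "'a set \<Rightarrow> 'a set set \<Rightarrow> ('a + 'a set \<Rightarrow> nat) \<Rightarrow> bool" where
  "edge_magic_total V E l \<longleftrightarrow>
     finite_simple_graph V E \<and>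
     bij_betw l (V <+> E) {1..card V + card E} \<and>
     (\<exists>k. \<forall>x y. {x, y} \<in> E \<longrightarrow> l (Inl x) + l (Inl y) + l (Inr {x, y}) = k)"

definition edge_consecutive_magic ::
    "'a set \<Rightarrow> 'a set set \<Rightarrow> nat \<Rightarrow> ('a + 'a set \<Rightarrow> nat) \<Rightarrow> bool" where
  "edge_consecutive_magic V E b l \<longleftrightarrow>
     b \<le> card V \<and>
     edge_magic_total V E l \<and>
     l ` (Inr ` E) = {b + 1..b + card E}"

text \<open>\<open>Spine i\<close> is the path vertex \<open>c\<^sub>i\<close>, and \<open>Leaf i j\<close> is the \<open>j\<close>-th leaf attached to it.
  Both indices start at 1.\<close>

datatype cat_vertex = Spine nat | Leaf nat nat

definition caterpillar_verts :: "nat \<Rightarrow> (nat \<Rightarrow> nat) \<Rightarrow> cat_vertex set" where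
  "caterpillar_verts r n =
     {Spine i | i. i \<in> {1..r}} \<union> {Leaf i j | i j. i \<in> {1..r} \<and> j \<in> {1..n i}}"

definition caterpillar_edges :: "nat \<Rightarrow> (nat \<Rightarrow> nat) \<Rightarrow> cat_vertex set set" where
  "caterpillar_edges r n =
     {{Spine i, Spine (i + 1)} | i. i \<in> {1..<r}} \<union>
     {{Spine i, Leaf i j} | i j. i \<in> {1..r} \<and> j \<in> {1..n i}}"

lemma finite_simple_graph_caterpillar:
  "finite_simple_graph (caterpillar_verts r n) (caterpillar_edges r n)"
proof -
  have "caterpillar_verts r n =
      Spine ` {1..r} \<union> (\<Union>i\<in>{1..r}. Leaf i ` {1..n i})"
    unfolding caterpillar_verts_def by auto
  then have "finite (caterpillar_verts r n)" by simp
  then show ?thesis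
    unfolding finite_simple_graph_def caterpillar_edges_def
    by (auto simp: caterpillar_verts_def)
qed

lemma floor_half: "nat \<lfloor>real r / 2\<rfloor> = r div 2"
  by linarith

lemma ceiling_half: "nat \<lceil>real r / 2\<rceil> = (r + 1) div 2"
  by linarith

end

theory Submission
  imports Defs
begin

text \<open>
  A tree has a unique proper 2-colouring, and the four values of \<open>b\<close> are \<open>0\<close>, the sizes of the two
  colour classes of the caterpillar, and their sum \<open>|V|\<close>.

  \<^bold>\<open>These values occur.\<close> Number the two colour classes \<open>A\<close> and \<open>B\<close> separately, each from 1, so that
  the sums of the two numbers along the edges are exactly \<open>2, \<dots>, |A| + |B|\<close>. In the plane this
  is the zigzag drawing of a caterpillar between two parallel lines without crossings; each edge
  in turn advances by one on one of the two lines. It is built one leaf at a time: a new vertex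
  is joined to the currently last vertex of the other class (\<open>staircase_add_vertex\<close>). Shifting \<open>A\<close>
  and \<open>B\<close> by constants and labelling the edges in decreasing order of their sums gives a magic
  labeling. The edge labels may lie below all vertices, above all of them, or between \<open>A\<close> and \<open>B\<close>
  in either order, which gives the four values (\<open>staircase_edge_consecutive_magic\<close>).

  \<^bold>\<open>No other value occurs.\<close> As the edge labels are consecutive, so are the sums of the end labels of
  the edges. Call a vertex small if its label is at most \<open>b\<close>; every other vertex label exceeds
  \<open>b + |E|\<close>. The sums along edges with two small ends, one small end and no small end fall into three
  ranges that are separated by gaps, so at most one of the ranges occurs
  (\<open>edge_consecutive_magic_cross_all_or_none\<close> gives the part of this that matters). Either
  smallness is constant along edges, and by connectedness \<open>b\<close> is \<open>0\<close> or \<open>|V|\<close>, or it changes along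
  every edge, and the \<open>b\<close> small vertices form a colour class.
\<close>

section \<open>Staircase numberings of bipartite graphs\<close>

text \<open>
  The colour classes \<open>A\<close> and \<open>B\<close> are numbered by \<open>g\<close>, and \<open>sum g e\<close> adds the numbers of the two
  ends of \<open>e\<close>. The equation for \<open>card E\<close> makes the edge sums distinct. The vertex \<open>x\<close> is the last
  one of \<open>A\<close>, the place where the numbering can be continued. Apart from the role of \<open>x\<close>, the notion
  is symmetric in \<open>A\<close> and \<open>B\<close>.
\<close>

definition staircase ::
    "'a set \<Rightarrow> 'a set \<Rightarrow> 'a set set \<Rightarrow> ('a \<Rightarrow> nat) \<Rightarrow> 'a \<Rightarrow> bool" where
  "staircase A B E g x \<longleftrightarrow>
     finite A \<and> finite B \<and> A \<inter> B = {} \<and>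
     (\<forall>e\<in>E. \<exists>a\<in>A. \<exists>c\<in>B. e = {a, c}) \<and>
     g ` A = {1..card A} \<and> g ` B = {1..card B} \<and>
     sum g ` E = {2..card A + card B} \<and>
     card E + 1 = card A + card B \<and>
     x \<in> A \<and> g x = card A"

lemma staircase_singleton: "staircase {x} {} {} (\<lambda>_. 1) x"
  unfolding staircase_def by auto

text \<open>
  Both ends of the new edge are last in their classes, so its sum is the next one, one larger than
  all sums so far. Afterwards one may go on at \<open>x\<close> (so \<open>y\<close> becomes a leaf) or at \<open>y\<close> (so \<open>y\<close>
  becomes the next spine vertex); in the latter case the two classes exchange their roles.
\<close>

lemma staircase_add_vertex:
  assumes st: "staircase A B E g x" and y: "y \<notin> A \<union> B"
  defines "g' \<equiv> g(y := card B + 1)"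
  shows "staircase A (insert y B) (insert {x, y} E) g' x" (is ?same)
    and "staircase (insert y B) A (insert {x, y} E) g' y" (is ?other)
proof -
  have fin: "finite A" "finite B" and disj: "A \<inter> B = {}"
    and cross: "\<And>e. e \<in> E \<Longrightarrow> \<exists>a\<in>A. \<exists>c\<in>B. e = {a, c}"
    and g: "g ` A = {1..card A}" "g ` B = {1..card B}" "sum g ` E = {2..card A + card B}"
    and cardE: "card E + 1 = card A + card B"
    and x: "x \<in> A" "g x = card A"
    using st by (auto simp: staircase_def)
  have xy: "x \<noteq> y" using x y by blast
  have edge: "e \<subseteq> A \<union> B" if "e \<in> E" for e
    using cross[OF that] by blast
  have "g' ` A = g ` A" "g' ` B = g ` B"
    using y by (auto simp: g'_def intro!: image_cong)
  hence g'A: "g' ` A = {1..card A}" and g'B: "g' ` insert y B = {1..card (insert y B)}"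
    using g fin y by (auto simp: g'_def)
  have "sum g' ` E = sum g ` E"
  proof (intro image_cong refl sum.cong)
    fix e v assume "e \<in> E" "v \<in> e"
    thus "g' v = g v" using edge y by (auto simp: g'_def)
  qed
  moreover have "sum g' {x, y} = card A + card B + 1"
    using x xy by (simp add: g'_def)
  moreover have "card A \<ge> 1"
    using x fin by (auto simp: Suc_le_eq card_gt_0_iff)
  ultimately have sums: "sum g' ` insert {x, y} E = {2..card A + card (insert y B)}"
    unfolding image_insert using g fin y by auto
  have "{x, y} \<notin> E" using edge y by blast
  moreover have "finite E"
    by (rule finite_subset[of E "Pow (A \<union> B)"]) (use edge fin in auto)
  ultimately have cardE': "card (insert {x, y} E) + 1 = card A + card (insert y B)"
    using cardE fin y by simp
  have crossE: "\<forall>e\<in>insert {x, y} E. \<exists>a\<in>A. \<exists>c\<in>insert y B. e = {a, c}"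
    using cross x by blast
  have crossE': "\<forall>e\<in>insert {x, y} E. \<exists>a\<in>insert y B. \<exists>c\<in>A. e = {a, c}"
  proof
    fix e assume "e \<in> insert {x, y} E"
    then obtain a c where "a \<in> A" "c \<in> insert y B" "e = {a, c}" using crossE by blast
    moreover from this have "e = {c, a}" by blast
    ultimately show "\<exists>a\<in>insert y B. \<exists>c\<in>A. e = {a, c}" by blast
  qed
  have top: "g' x = card A" "g' y = card (insert y B)"
    using x xy y fin by (auto simp: g'_def)
  have disj': "A \<inter> insert y B = {}" "insert y B \<inter> A = {}"
    using disj y by auto
  have fin': "finite (insert y B)" using fin by simp
  show ?same
    unfolding staircase_def
    by (intro conjI fin fin' disj' crossE g'A g'B sums cardE' x top)
  show ?other
    unfolding staircase_def add.commute[of "card (insert y B)"]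
    by (intro conjI fin fin' disj' crossE' g'A g'B sums cardE' insertI1 top)
qed

text \<open>
  A vertex gets its number plus the shift \<open>\<alpha>\<close> or \<open>\<beta>\<close> of its class, and an edge with sum \<open>s\<close> gets
  \<open>b + |A| + |B| + 1 - s\<close>, so that \<open>s\<close> cancels along every edge. The last hypothesis says that the
  shifted classes fill precisely the labels outside \<open>b + 1, \<dots>, b + |E|\<close>; then the labeling is onto,
  and by counting it is a bijection.
\<close>

lemma staircase_imp_labeling:
  assumes st: "staircase A B E g x"
    and b: "b \<le> card A + card B"
    and labels: "{\<alpha> + 1..\<alpha> + card A} \<union> {\<beta> + 1..\<beta> + card B} =
      {1..b} \<union> {b + card A + card B..card A + card B + card E}"
  shows "\<exists>l. edge_consecutive_magic (A \<union> B) E b l"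
proof -
  note st' = st[unfolded staircase_def]
  define p where "p = card A + card B"
  have fin: "finite A" "finite B" and disj: "A \<inter> B = {}" and q: "card E + 1 = p"
    and cross: "\<And>e. e \<in> E \<Longrightarrow> \<exists>a\<in>A. \<exists>c\<in>B. e = {a, c}"
    using st' by (auto simp: p_def)
  have p: "card (A \<union> B) = p"
    using fin disj by (simp add: p_def card_Un_disjoint)
  have finE: "finite E"
    using cross fin by (intro finite_subset[of E "Pow (A \<union> B)"]) fastforce+
  define l where
    "l = case_sum (\<lambda>v. (if v \<in> A then \<alpha> else \<beta>) + g v) (\<lambda>e. b + p + 1 - sum g e)"
  have "(\<lambda>v. l (Inl v)) ` A = (\<lambda>i. \<alpha> + i) ` g ` A"
    unfolding image_image by (intro image_cong) (auto simp: l_def)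
  moreover have "(\<lambda>v. l (Inl v)) ` B = (\<lambda>i. \<beta> + i) ` g ` B"
    unfolding image_image using disj by (intro image_cong) (auto simp: l_def)
  ultimately have vert: "(\<lambda>v. l (Inl v)) ` (A \<union> B) = {1..b} \<union> {b + p..p + card E}"
    using st' labels by (simp add: image_Un p_def ac_simps)
  have "(\<lambda>e. l (Inr e)) ` E = (\<lambda>s. b + p + 1 - s) ` sum g ` E"
    unfolding image_image by (simp add: l_def)
  also have "\<dots> = (\<lambda>s. b + p + 1 - s) ` {2..p}"
    using st' by (simp add: p_def)
  also have "\<dots> = {b + 1..b + card E}"
  proof (intro equalityI subsetI)
    fix u assume "u \<in> {b + 1..b + card E}"
    hence "u = b + p + 1 - (b + p + 1 - u)" "b + p + 1 - u \<in> {2..p}"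
      using q by auto
    thus "u \<in> (\<lambda>s. b + p + 1 - s) ` {2..p}" by (rule image_eqI)
  qed (use q in auto)
  finally have edges: "(\<lambda>e. l (Inr e)) ` E = {b + 1..b + card E}" .
  have simple: "finite_simple_graph (A \<union> B) E"
    unfolding finite_simple_graph_def
  proof (intro conjI ballI)
    fix e assume "e \<in> E"
    then obtain a c where ac: "a \<in> A" "c \<in> B" "e = {a, c}" using cross by blast
    moreover from ac have "a \<noteq> c" using disj by blast
    ultimately show "e \<subseteq> A \<union> B" "card e = 2" by auto
  qed (use fin in simp)
  have "l ` ((A \<union> B) <+> E) = {1..p + card E}"
    using vert edges q b unfolding Plus_def image_Un image_image p_def by auto
  moreover from this have "inj_on l ((A \<union> B) <+> E)"
    using fin finE p by (intro eq_card_imp_inj_on) (auto simp: card_Plus)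
  ultimately have bij: "bij_betw l ((A \<union> B) <+> E) {1..card (A \<union> B) + card E}"
    unfolding bij_betw_def p by simp
  have "l (Inl u) + l (Inl v) + l (Inr {u, v}) = \<alpha> + \<beta> + b + p + 1"
    if "{u, v} \<in> E" for u v
  proof -
    obtain a c where ac: "a \<in> A" "c \<in> B" "{u, v} = {a, c}" using cross \<open>{u, v} \<in> E\<close> by blast
    have "sum g {u, v} \<le> p" using that st' by (auto simp: p_def)
    moreover have "u \<noteq> v" using ac disj by (auto simp: doubleton_eq_iff)
    moreover have "u \<in> A \<and> v \<notin> A \<or> u \<notin> A \<and> v \<in> A" using ac disj by (auto simp: doubleton_eq_iff)
    ultimately show ?thesis by (auto simp: l_def)
  qed
  hence "edge_magic_total (A \<union> B) E l"
    unfolding edge_magic_total_def using simple bij by blast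
  moreover have "l ` Inr ` E = {b + 1..b + card E}"
    using edges by (simp add: image_image)
  ultimately show ?thesis
    unfolding edge_consecutive_magic_def using b p by (auto simp: p_def)
qed

lemma staircase_edge_consecutive_magic:
  assumes st: "staircase A B E g x"
    and b: "b \<in> {0, card A, card B, card A + card B}"
  shows "\<exists>l. edge_consecutive_magic (A \<union> B) E b l"
proof -
  let ?s = "card A" and ?t = "card B"
  have q: "card E + 1 = ?s + ?t" using st by (simp add: staircase_def)
  consider "b = 0" | "b = ?s" | "b = ?t" | "b = ?s + ?t" using b by blast
  thus ?thesis
  proof cases
    case 1
    with q show ?thesis
      by (intro staircase_imp_labeling[OF st, where \<alpha> = "card E" and \<beta> = "card E + ?s"]) auto
  next
    case 2
    with q show ?thesis
      by (intro staircase_imp_labeling[OF st, where \<alpha> = 0 and \<beta> = "card E + ?s"]) auto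
  next
    case 3
    with q show ?thesis
      by (intro staircase_imp_labeling[OF st, where \<alpha> = "card E + ?t" and \<beta> = 0]) auto
  next
    case 4
    with q show ?thesis
      by (intro staircase_imp_labeling[OF st, where \<alpha> = 0 and \<beta> = ?s]) auto
  qed
qed

section \<open>Edges between small and large vertex labels\<close>

text \<open>
  Write \<open>p = |V|\<close> and \<open>q = |E|\<close>. The vertex labels are \<open>1, \<dots>, b\<close> and \<open>b + q + 1, \<dots>, p + q\<close>. Two distinct
  small labels add up to at most \<open>2b - 1\<close>, which is at most \<open>b + q\<close> because \<open>b \<le> p \<le> q + 1\<close>; mixed
  pairs give sums from \<open>b + q + 2\<close> to \<open>b + p + q\<close>; two distinct large labels give at least
  \<open>2b + 2q + 3\<close>, which is at least \<open>b + p + q + 2\<close>. Hence the values \<open>b + q + 1\<close> and \<open>b + p + q + 1\<close> are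
  never attained, whereas the sums over all edges form an interval.
\<close>

lemma edge_consecutive_magic_cross_all_or_none:
  assumes l: "edge_consecutive_magic V E b l"
    and few: "card V \<le> card E + 1"
  shows "(\<forall>u v. {u, v} \<in> E \<longrightarrow> (l (Inl u) \<le> b) \<noteq> (l (Inl v) \<le> b)) \<or>
    (\<forall>u v. {u, v} \<in> E \<longrightarrow> (l (Inl u) \<le> b) = (l (Inl v) \<le> b))"
proof (rule ccontr)
  assume "\<not> ?thesis"
  then obtain u v u' v' where uv: "{u, v} \<in> E" "(l (Inl u) \<le> b) = (l (Inl v) \<le> b)"
    and uv': "{u', v'} \<in> E" "(l (Inl u') \<le> b) \<noteq> (l (Inl v') \<le> b)" by blast
  let ?q = "card E" and ?p = "card V"
  have bp: "b \<le> ?p" and simple: "finite_simple_graph V E"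
    and bij: "bij_betw l (V <+> E) {1..?p + ?q}"
    and im: "l ` Inr ` E = {b + 1..b + ?q}"
    using l by (auto simp: edge_consecutive_magic_def edge_magic_total_def)
  obtain k where k: "\<And>x y. {x, y} \<in> E \<Longrightarrow> l (Inl x) + l (Inl y) + l (Inr {x, y}) = k"
    using l by (auto simp: edge_consecutive_magic_def edge_magic_total_def)
  have vert: "1 \<le> l (Inl x) \<and> l (Inl x) \<le> b \<or> b + ?q < l (Inl x) \<and> l (Inl x) \<le> ?p + ?q"
    if "x \<in> V" for x
  proof -
    have "l (Inl x) \<in> {1..?p + ?q}" using bij that by (auto simp: bij_betw_def)
    moreover have "l (Inl x) \<notin> l ` Inr ` E"
      using bij that by (auto simp: bij_betw_def inj_on_def)
    ultimately show ?thesis unfolding im by auto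
  qed
  have edge: "x \<in> V \<and> y \<in> V \<and> l (Inl x) \<noteq> l (Inl y)" if "{x, y} \<in> E" for x y
  proof -
    have "x \<in> V" "y \<in> V" "x \<noteq> y"
      using simple that by (auto simp: finite_simple_graph_def card_insert_if split: if_splits)
    moreover from this have "l (Inl x) \<noteq> l (Inl y)"
      using bij inj_onD[of l "V <+> E" "Inl x" "Inl y"] by (auto simp: bij_betw_def)
    ultimately show ?thesis by blast
  qed
  \<comment> \<open>The sums form an interval: a value between two of them is \<open>k\<close> minus an edge label.\<close>
  have attained: "\<exists>x y. {x, y} \<in> E \<and> l (Inl x) + l (Inl y) = w"
    if "{x1, y1} \<in> E" "{x2, y2} \<in> E"
      "l (Inl x1) + l (Inl y1) \<le> w" "w \<le> l (Inl x2) + l (Inl y2)" for x1 y1 x2 y2 w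
  proof -
    have "l (Inr {x1, y1}) \<in> {b + 1..b + ?q}" "l (Inr {x2, y2}) \<in> {b + 1..b + ?q}"
      unfolding im[symmetric] using that by auto
    hence "k - w \<in> {b + 1..b + ?q}" "w \<le> k" using k[OF that(1)] k[OF that(2)] that(3,4) by auto
    then obtain e where e: "e \<in> E" "l (Inr e) = k - w" unfolding im[symmetric] by auto
    then obtain x y where "e = {x, y}"
      using simple by (auto simp: finite_simple_graph_def card_2_iff)
    thus ?thesis using e k[of x y] \<open>w \<le> k\<close> by (intro exI[of _ x] exI[of _ y]) auto
  qed
  have missed: "l (Inl x) + l (Inl y) \<noteq> b + ?q + 1 \<and> l (Inl x) + l (Inl y) \<noteq> b + ?p + ?q + 1"
    if "{x, y} \<in> E" for x y
    using edge[OF that] vert[of x] vert[of y] bp few by linarith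
  show False
  proof (cases "l (Inl u) \<le> b")
    case True
    have "l (Inl u) + l (Inl v) \<le> b + ?q + 1" "b + ?q + 1 \<le> l (Inl u') + l (Inl v')"
      using True uv uv' edge[of u v] edge[of u' v'] vert[of u'] vert[of v'] bp few by auto
    thus False using attained uv uv' missed by blast
  next
    case False
    have "l (Inl u') + l (Inl v') \<le> b + ?p + ?q + 1" "b + ?p + ?q + 1 \<le> l (Inl u) + l (Inl v)"
      using False uv uv' edge[of u v] edge[of u' v'] vert[of u] vert[of v] vert[of u'] vert[of v']
        bp few by auto
    thus False using attained uv uv' missed by blast
  qed
qed

lemma card_small_labels:
  assumes l: "edge_consecutive_magic V E b l"
  shows "card {v \<in> V. l (Inl v) \<le> b} = b"
proof -
  have bp: "b \<le> card V" and bij: "bij_betw l (V <+> E) {1..card V + card E}"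
    and im: "l ` Inr ` E = {b + 1..b + card E}"
    using l by (auto simp: edge_consecutive_magic_def edge_magic_total_def)
  have "(\<lambda>v. l (Inl v)) ` {v \<in> V. l (Inl v) \<le> b} = {1..b}"
  proof (intro equalityI subsetI)
    fix i assume i: "i \<in> {1..b}"
    hence "i \<in> l ` (V <+> E)" using bij bp by (auto simp: bij_betw_def)
    moreover have "i \<notin> l ` Inr ` E" unfolding im using i by auto
    ultimately show "i \<in> (\<lambda>v. l (Inl v)) ` {v \<in> V. l (Inl v) \<le> b}"
      using i by auto
  next
    fix i assume "i \<in> (\<lambda>v. l (Inl v)) ` {v \<in> V. l (Inl v) \<le> b}"
    moreover from this have "i \<in> {1..card V + card E}" using bij by (auto simp: bij_betw_def)
    ultimately show "i \<in> {1..b}" by auto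
  qed
  moreover have "inj_on (\<lambda>v. l (Inl v)) {v \<in> V. l (Inl v) \<le> b}"
    using bij by (auto simp: bij_betw_def inj_on_def)
  ultimately show ?thesis using card_image by fastforce
qed

section \<open>The colour classes of a caterpillar\<close>

text \<open>
  The proper 2-colouring in which the colour of \<open>Spine 1\<close> is \<open>True\<close>.
\<close>

fun colour :: "cat_vertex \<Rightarrow> bool" where
  "colour (Spine i) = odd i"
| "colour (Leaf i j) = even i"

definition colour_class :: "nat \<Rightarrow> (nat \<Rightarrow> nat) \<Rightarrow> bool \<Rightarrow> cat_vertex set" where
  "colour_class r n c = {v \<in> caterpillar_verts r n. colour v = c}"

lemma colour_class_Un: "colour_class r n c \<union> colour_class r n (\<not> c) = caterpillar_verts r n"
  unfolding colour_class_def by auto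

lemma caterpillar_verts_new_spine:
  assumes "n (Suc r) = 0"
  shows "caterpillar_verts (Suc r) n = insert (Spine (Suc r)) (caterpillar_verts r n)"
  unfolding caterpillar_verts_def using assms by (auto simp: le_Suc_eq)

lemma caterpillar_edges_new_spine:
  assumes "n (Suc r) = 0" "r \<ge> 1"
  shows "caterpillar_edges (Suc r) n =
    insert {Spine r, Spine (Suc r)} (caterpillar_edges r n)"
  unfolding caterpillar_edges_def using assms by (auto simp: le_Suc_eq less_Suc_eq)

text \<open>
  A caterpillar with a leaf at its last spine vertex arises from the one with one leaf fewer there,
  which is the caterpillar for \<open>n(r := m)\<close>.
\<close>

lemma leaf_index_insert:
  fixes n :: "nat \<Rightarrow> nat"
  assumes "n r = Suc m" "r \<ge> 1"
  shows "i \<in> {1..r} \<and> j \<in> {1..n i} \<longleftrightarrow>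
    i = r \<and> j = Suc m \<or> i \<in> {1..r} \<and> j \<in> {1..(n(r := m)) i}"
  using assms by (cases "i = r") auto

lemma caterpillar_verts_new_leaf:
  assumes "n r = Suc m" "r \<ge> 1"
  shows "caterpillar_verts r n = insert (Leaf r (Suc m)) (caterpillar_verts r (n(r := m)))"
  unfolding caterpillar_verts_def leaf_index_insert[of n r m, OF assms] by blast

lemma caterpillar_edges_new_leaf:
  assumes "n r = Suc m" "r \<ge> 1"
  shows "caterpillar_edges r n =
    insert {Spine r, Leaf r (Suc m)} (caterpillar_edges r (n(r := m)))"
  unfolding caterpillar_edges_def leaf_index_insert[of n r m, OF assms] by blast

lemma colour_class_insert:
  assumes "caterpillar_verts r n = insert v (caterpillar_verts r' n')"
  shows "colour_class r n (colour v) = insert v (colour_class r' n' (colour v))"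
    and "colour_class r n (\<not> colour v) = colour_class r' n' (\<not> colour v)"
  using assms unfolding colour_class_def by auto

text \<open>
  The caterpillar grows from its first spine vertex in the order: all leaves at the current spine
  vertex, then the next spine vertex. So at each moment the last spine vertex is where the
  staircase can be continued, and its colour class takes the first place.
\<close>

lemma caterpillar_staircase:
  assumes "r \<ge> 1"
  shows "\<exists>g. staircase (colour_class r n (odd r)) (colour_class r n (even r))
    (caterpillar_edges r n) g (Spine r)"
proof -
  define P where "P r n \<longleftrightarrow> (\<exists>g. staircase (colour_class r n (odd r)) (colour_class r n (even r))
    (caterpillar_edges r n) g (Spine r))" for r n
  have leaves: "P r n" if "r \<ge> 1" "P r (n(r := 0))" for r n
    using that(2)
  proof (induction "n r" arbitrary: n)
    case 0
    thus ?case by (metis fun_upd_triv)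
  next
    case (Suc m)
    have nr: "n r = Suc m" using Suc by simp
    have "P r (n(r := m))" using Suc by simp
    then obtain g where g: "staircase (colour_class r (n(r := m)) (odd r))
        (colour_class r (n(r := m)) (even r)) (caterpillar_edges r (n(r := m))) g (Spine r)"
      unfolding P_def by blast
    have "Leaf r (Suc m) \<notin> caterpillar_verts r (n(r := m))"
      by (auto simp: caterpillar_verts_def)
    hence new: "Leaf r (Suc m) \<notin> colour_class r (n(r := m)) (odd r) \<union> colour_class r (n(r := m)) (even r)"
      by (simp add: colour_class_def)
    note cl = colour_class_insert[OF caterpillar_verts_new_leaf[of n r m, OF nr \<open>r \<ge> 1\<close>]]
    show ?case
      unfolding P_def caterpillar_edges_new_leaf[of n r m, OF nr \<open>r \<ge> 1\<close>]
      using staircase_add_vertex(1)[OF g new] cl by auto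
  qed
  have "P r n"
    using assms
  proof (induction r arbitrary: n rule: dec_induct)
    case base
    have "colour_class 1 (n(1 := 0)) True = {Spine 1}" "colour_class 1 (n(1 := 0)) False = {}"
      "caterpillar_edges 1 (n(1 := 0)) = {}"
      by (auto simp: colour_class_def caterpillar_verts_def caterpillar_edges_def)
    hence "P 1 (n(1 := 0))"
      using staircase_singleton[of "Spine 1"] by (auto simp: P_def)
    thus ?case using leaves[of 1 n] by simp
  next
    case (step r)
    define n' where "n' = n(Suc r := 0)"
    have n': "n' (Suc r) = 0" by (simp add: n'_def)
    obtain g where g: "staircase (colour_class r n' (odd r)) (colour_class r n' (even r))
        (caterpillar_edges r n') g (Spine r)"
      using step unfolding P_def by blast
    have "Spine (Suc r) \<notin> caterpillar_verts r n'"
      by (auto simp: caterpillar_verts_def)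
    hence new: "Spine (Suc r) \<notin> colour_class r n' (odd r) \<union> colour_class r n' (even r)"
      by (simp add: colour_class_def)
    note cl = colour_class_insert[OF caterpillar_verts_new_spine[of n' r, OF n']]
    have "P (Suc r) n'"
      unfolding P_def caterpillar_edges_new_spine[of n' r, OF n' \<open>1 \<le> r\<close>]
      using staircase_add_vertex(2)[OF g new] cl by auto
    thus ?case using leaves[of "Suc r" n] by (simp add: n'_def)
  qed
  thus ?thesis unfolding P_def .
qed

lemma sum_odd_even_split:
  fixes f g :: "nat \<Rightarrow> nat"
  shows "(\<Sum>i = 1..r. if odd i then f i else g i) =
    (\<Sum>i = 1..(r + 1) div 2. f (2 * i - 1)) + (\<Sum>i = 1..r div 2. g (2 * i))"
proof (induction r)
  case (Suc r)
  show ?case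
  proof (cases "odd r")
    case True
    then obtain k where "r = 2 * k + 1" by (elim oddE)
    thus ?thesis using Suc by simp
  next
    case False
    then obtain k where "r = 2 * k" by auto
    thus ?thesis using Suc by simp
  qed
qed simp

text \<open>
  The spine index \<open>i\<close> contributes to one colour class the vertex \<open>Spine i\<close> and to the other one
  its \<open>n i\<close> leaves.
\<close>

lemma card_colour_class:
  "card (colour_class r n c) = (\<Sum>i = 1..r. if odd i = c then 1 else n i)"
proof -
  have "colour_class r n c =
      (\<Union>i\<in>{1..r}. if odd i = c then {Spine i} else Leaf i ` {1..n i})"
    unfolding colour_class_def caterpillar_verts_def by (auto split: if_splits)
  also have "card \<dots> = (\<Sum>i = 1..r. card (if odd i = c then {Spine i} else Leaf i ` {1..n i}))"
    by (intro card_UN_disjoint) auto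
  also have "\<dots> = (\<Sum>i = 1..r. if odd i = c then 1 else n i)"
    by (intro sum.cong) (auto simp: card_image inj_on_def)
  finally show ?thesis .
qed

lemma card_odd_colour_class:
  "card (colour_class r n True) = (\<Sum>i = 1..r div 2. n (2 * i)) + (r + 1) div 2"
  using sum_odd_even_split[where f = "\<lambda>_. 1" and g = n] by (simp add: card_colour_class)

lemma card_even_colour_class:
  "card (colour_class r n False) = (\<Sum>i = 1..(r + 1) div 2. n (2 * i - 1)) + r div 2"
proof -
  have "card (colour_class r n False) = (\<Sum>i = 1..r. if odd i then n i else 1)"
    unfolding card_colour_class by (intro sum.cong) auto
  thus ?thesis using sum_odd_even_split[where f = n and g = "\<lambda>_. 1"] by simp
qed

lemma card_colour_classes_add:
  "card (colour_class r n True) + card (colour_class r n False) = (\<Sum>i = 1..r. n i) + r"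
proof -
  have "card (colour_class r n True) + card (colour_class r n False) = (\<Sum>i = 1..r. n i + 1)"
    unfolding card_colour_class sum.distrib[symmetric] by (intro sum.cong) auto
  thus ?thesis by (simp add: sum_Suc)
qed

text \<open>
  This is the connectedness of the caterpillar, in the form of an induction rule: a property passes
  along the edges from the first spine vertex to every vertex.
\<close>

lemma caterpillar_vertex_invariant:
  assumes spine: "\<And>i. {Spine i, Spine (Suc i)} \<in> caterpillar_edges r n \<Longrightarrow>
      P (Spine i) \<Longrightarrow> P (Spine (Suc i))"
    and leaf: "\<And>i j. {Spine i, Leaf i j} \<in> caterpillar_edges r n \<Longrightarrow>
      P (Spine i) \<Longrightarrow> P (Leaf i j)"
    and start: "P (Spine 1)" and v: "v \<in> caterpillar_verts r n"
  shows "P v"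
proof -
  have path: "P (Spine i)" if "1 \<le> i" "i \<le> r" for i
    using that
  proof (induction i rule: dec_induct)
    case base
    show ?case by (rule start)
  next
    case (step i)
    thus ?case by (intro spine) (auto simp: caterpillar_edges_def)
  qed
  show ?thesis
  proof (cases v)
    case (Spine i)
    thus ?thesis using v path by (auto simp: caterpillar_verts_def)
  next
    case (Leaf i j)
    hence ij: "i \<in> {1..r}" "j \<in> {1..n i}" using v by (auto simp: caterpillar_verts_def)
    hence "{Spine i, Leaf i j} \<in> caterpillar_edges r n" by (auto simp: caterpillar_edges_def)
    thus ?thesis using leaf path ij Leaf by simp
  qed
qed

section \<open>The possible values of b\<close>

theorem theorem7:
  fixes r :: nat and n :: "nat \<Rightarrow> nat" and b :: nat
  assumes "r \<ge> 1"
  shows "(\<exists>l. edge_consecutive_magic (caterpillar_verts r n) (caterpillar_edges r n) b l) \<longleftrightarrow>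
    b \<in> {0,
         (\<Sum>i = 1..(r + 1) div 2. n (2 * i - 1)) + r div 2,
         (\<Sum>i = 1..r div 2. n (2 * i)) + (r + 1) div 2,
         (\<Sum>i = 1..r. n i) + r}"
proof -
  let ?V = "caterpillar_verts r n" and ?E = "caterpillar_edges r n"
  let ?A = "colour_class r n True" and ?B = "colour_class r n False"
  have goal: "(b \<in> {0,
         (\<Sum>i = 1..(r + 1) div 2. n (2 * i - 1)) + r div 2,
         (\<Sum>i = 1..r div 2. n (2 * i)) + (r + 1) div 2,
         (\<Sum>i = 1..r. n i) + r}) = (b \<in> {0, card ?B, card ?A, card ?A + card ?B})"
    by (simp only: card_odd_colour_class card_even_colour_class
        card_colour_classes_add[unfolded card_odd_colour_class card_even_colour_class])
  obtain g where g: "staircase (colour_class r n (odd r)) (colour_class r n (even r)) ?E g (Spine r)"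
    using caterpillar_staircase[OF assms] by blast
  have V: "?A \<union> ?B = ?V" "colour_class r n (odd r) \<union> colour_class r n (even r) = ?V"
    using colour_class_Un[of r n True] colour_class_Un[of r n "odd r"] by auto
  have cardV: "card ?V = card ?A + card ?B"
    unfolding V(1)[symmetric] using finite_simple_graph_caterpillar[of r n]
    by (intro card_Un_disjoint) (auto simp: colour_class_def finite_simple_graph_def)
  have cardE: "card ?V = card ?E + 1"
    using g cardV by (cases "odd r") (auto simp: staircase_def)
  show ?thesis
    unfolding goal
  proof
    assume "b \<in> {0, card ?B, card ?A, card ?A + card ?B}"
    hence "b \<in> {0, card (colour_class r n (odd r)), card (colour_class r n (even r)),
        card (colour_class r n (odd r)) + card (colour_class r n (even r))}"
      by (cases "odd r") auto
    from staircase_edge_consecutive_magic[OF g this]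
    show "\<exists>l. edge_consecutive_magic ?V ?E b l" by (simp only: V)
  next
    assume "\<exists>l. edge_consecutive_magic ?V ?E b l"
    then obtain l where l: "edge_consecutive_magic ?V ?E b l" ..
    define small where "small v \<longleftrightarrow> l (Inl v) \<le> b" for v
    have b: "card {v \<in> ?V. small v} = b"
      using card_small_labels[OF l] by (simp add: small_def)
    consider (cross) "\<And>u v. {u, v} \<in> ?E \<Longrightarrow> small u \<noteq> small v"
      | (none) "\<And>u v. {u, v} \<in> ?E \<Longrightarrow> small u = small v"
      using edge_consecutive_magic_cross_all_or_none[OF l] cardE
      unfolding small_def by (metis order_refl)
    thus "b \<in> {0, card ?B, card ?A, card ?A + card ?B}"
    proof cases
      case cross
      \<comment> \<open>Both smallness and colour change along every edge, so their agreement is constant,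
        and at \<open>Spine 1\<close>, which has colour \<open>True\<close>, agreement means smallness.\<close>
      have "(small v = colour v) = small (Spine 1)" if "v \<in> ?V" for v
      proof (rule caterpillar_vertex_invariant[OF _ _ _ that])
        fix i assume "{Spine i, Spine (Suc i)} \<in> ?E" "(small (Spine i) = colour (Spine i)) = small (Spine 1)"
        with cross[of "Spine i" "Spine (Suc i)"]
        show "(small (Spine (Suc i)) = colour (Spine (Suc i))) = small (Spine 1)" by auto
      next
        fix i j assume "{Spine i, Leaf i j} \<in> ?E" "(small (Spine i) = colour (Spine i)) = small (Spine 1)"
        with cross[of "Spine i" "Leaf i j"]
        show "(small (Leaf i j) = colour (Leaf i j)) = small (Spine 1)" by auto
      qed simp
      hence "{v \<in> ?V. small v} = colour_class r n (small (Spine 1))"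
        unfolding colour_class_def by auto
      thus ?thesis using b by (cases "small (Spine 1)") auto
    next
      case none
      have "small v = small (Spine 1)" if "v \<in> ?V" for v
        by (rule caterpillar_vertex_invariant[OF _ _ _ that,
              where P = "\<lambda>v. small v = small (Spine 1)"]) (use none in metis)+
      hence "{v \<in> ?V. small v} = (if small (Spine 1) then ?V else {})" by auto
      thus ?thesis using b cardV by (auto split: if_splits)
    qed
  qed
qed

end
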